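(* Let $n\ge2$, let $\Phi:[0,1]^n\to[0,1]$ be an averaging aggregation operator, let $w\in[0,1]^n$ satisfy $\sum_{k=1}^n w_k=1$, and let $\alpha\in[0,1]$. Then $$\mathcal{R}_\alpha\subseteq\mathcal{R}_\alpha^{\Phi}\cap\mathcal{R}_\alpha^{w,\Phi}\cap\mathcal{R}_\alpha^{w}.$$
   Context: An averaging aggregation operator $\Phi:[0,1]^n\to[0,1]$ is a function that is nondecreasing in each argument and satisfies $\min(x)\le\Phi(x)\le\max(x)$ for all $x\in[0,1]^n$. For $x\in[0,1]^n$ define $\kappa(x)=\max_{1\le i<j\le n}|x_i-x_j|$, $\kappa^\Phi(x)=\max_{i=1,\dots,n}|x_i-\Phi(x)|$, $\kappa^{w,\Phi}(x)=\sum_{k=1}^n w_k|x_k-\Phi(x)|$, $\kappa^w(x)=\sum_{k=1}^{n-1}\sum_{l=k+1}^n\frac{w_k+w_l}{n-1}|x_k-x_l|$. The regions are $\mathcal{R}_\alpha=\{x\in[0,1]^n:\kappa(x)\le\alpha\}$, $\mathcal{R}^\Phi_\alpha=\{x\in[0,1]^n:\kappa^\Phi(x)\le\alpha\}$, $\mathcal{R}^{w,\Phi}_\alpha=\{x\in[0,1]^n:\kappa^{w,\Phi}(x)\le\alpha\}$, $\mathcal{R}^{w}_\alpha=\{x\in[0,1]^n:\kappa^{w}(x)\le\alpha\}$. *)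

theory Defs
  imports Complex_Main "HOL-Library.FuncSet"
begin

text \<open>Points of the \<open>n\<close>-dimensional unit cube are functions on \<open>{1..n}\<close>; extensionality
  (value \<open>undefined\<close> outside \<open>{1..n}\<close>) makes each point have exactly one representative.\<close>

definition unit_cube :: "nat \<Rightarrow> (nat \<Rightarrow> real) set" where
  "unit_cube n = {1..n} \<rightarrow>\<^sub>E {0..1}"

definition averaging_operator :: "nat \<Rightarrow> ((nat \<Rightarrow> real) \<Rightarrow> real) \<Rightarrow> bool" where
  "averaging_operator n \<Phi> \<longleftrightarrow>
     \<Phi> \<in> unit_cube n \<rightarrow> {0..1} \<and>
     (\<forall>x\<in>unit_cube n. \<forall>i\<in>{1..n}. \<forall>t\<in>{0..1}. x i \<le> t \<longrightarrow> \<Phi> x \<le> \<Phi> (x(i := t))) \<and>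
     (\<forall>x\<in>unit_cube n. Min (x ` {1..n}) \<le> \<Phi> x \<and> \<Phi> x \<le> Max (x ` {1..n}))"

text \<open>The two maxima below are over finite sets, which are nonempty for \<open>n \<ge> 2\<close>
  and \<open>n \<ge> 1\<close> respectively; for smaller \<open>n\<close> their values are unspecified.\<close>

definition kappa :: "nat \<Rightarrow> (nat \<Rightarrow> real) \<Rightarrow> real" where
  "kappa n x = Max {\<bar>x i - x j\<bar> | i j. 1 \<le> i \<and> i < j \<and> j \<le> n}"

definition kappa_op :: "nat \<Rightarrow> ((nat \<Rightarrow> real) \<Rightarrow> real) \<Rightarrow> (nat \<Rightarrow> real) \<Rightarrow> real" where
  "kappa_op n \<Phi> x = Max ((\<lambda>i. \<bar>x i - \<Phi> x\<bar>) ` {1..n})"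

definition kappa_weighted_op ::
    "nat \<Rightarrow> (nat \<Rightarrow> real) \<Rightarrow> ((nat \<Rightarrow> real) \<Rightarrow> real) \<Rightarrow> (nat \<Rightarrow> real) \<Rightarrow> real" where
  "kappa_weighted_op n w \<Phi> x = (\<Sum>k=1..n. w k * \<bar>x k - \<Phi> x\<bar>)"

definition kappa_weighted :: "nat \<Rightarrow> (nat \<Rightarrow> real) \<Rightarrow> (nat \<Rightarrow> real) \<Rightarrow> real" where
  "kappa_weighted n w x =
     (\<Sum>k=1..n-1. \<Sum>l=k+1..n. (w k + w l) / (real n - 1) * \<bar>x k - x l\<bar>)"

definition region :: "nat \<Rightarrow> real \<Rightarrow> (nat \<Rightarrow> real) set" where
  "region n \<alpha> = {x \<in> unit_cube n. kappa n x \<le> \<alpha>}"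

definition region_op :: "nat \<Rightarrow> ((nat \<Rightarrow> real) \<Rightarrow> real) \<Rightarrow> real \<Rightarrow> (nat \<Rightarrow> real) set" where
  "region_op n \<Phi> \<alpha> = {x \<in> unit_cube n. kappa_op n \<Phi> x \<le> \<alpha>}"

definition region_weighted_op ::
    "nat \<Rightarrow> (nat \<Rightarrow> real) \<Rightarrow> ((nat \<Rightarrow> real) \<Rightarrow> real) \<Rightarrow> real \<Rightarrow> (nat \<Rightarrow> real) set" where
  "region_weighted_op n w \<Phi> \<alpha> = {x \<in> unit_cube n. kappa_weighted_op n w \<Phi> x \<le> \<alpha>}"

definition region_weighted :: "nat \<Rightarrow> (nat \<Rightarrow> real) \<Rightarrow> real \<Rightarrow> (nat \<Rightarrow> real) set" where
  "region_weighted n w \<alpha> = {x \<in> unit_cube n. kappa_weighted n w x \<le> \<alpha>}"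

end

theory Submission
  imports Defs
begin

text \<open>
  A point of \<open>region n \<alpha>\<close> has all its coordinates within distance \<open>\<alpha>\<close> of each other. Since an
  averaging operator takes a value between the least and the greatest coordinate, that value is
  also within \<open>\<alpha>\<close> of every coordinate (\<open>averaging_value_close\<close>), which bounds \<open>kappa_op\<close>. The two
  remaining measures are weighted means of numbers that are at most \<open>\<alpha>\<close>: the weights of
  \<open>kappa_weighted_op\<close> sum to 1 by assumption, and those of \<open>kappa_weighted\<close> do so because every
  index lies in exactly \<open>n - 1\<close> pairs (\<open>sum_pair_weights\<close>).
\<close>

lemma region_pairwise_close:
  assumes "x \<in> region n \<alpha>" "0 \<le> \<alpha>" "i \<in> {1..n}" "j \<in> {1..n}"
  shows "\<bar>x i - x j\<bar> \<le> \<alpha>"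
proof -
  define D where "D = {\<bar>x i - x j\<bar> | i j. 1 \<le> i \<and> i < j \<and> j \<le> n}"
  have "D \<subseteq> (\<lambda>(i, j). \<bar>x i - x j\<bar>) ` ({1..n} \<times> {1..n})"
    by (force simp: D_def)
  hence "finite D"
    by (rule finite_subset) simp
  moreover have "Max D \<le> \<alpha>"
    using assms(1) by (simp add: region_def kappa_def D_def)
  ultimately have bound: "d \<le> \<alpha>" if "d \<in> D" for d
    using that by (meson Max_ge order_trans)
  have ordered: "\<bar>x i - x j\<bar> \<le> \<alpha>" if "1 \<le> i" "i < j" "j \<le> n" for i j
    using that by (intro bound) (auto simp: D_def)
  show ?thesis
    using ordered[of i j] ordered[of j i] assms(2-4)
    by (cases i j rule: linorder_cases) (auto simp: abs_minus_commute)
qed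

text \<open>The extreme coordinates are attained, so the bounds by minimum and maximum place the value
  of the operator between two coordinates, each within \<open>\<alpha>\<close> of \<open>x i\<close>.\<close>

lemma averaging_value_close:
  assumes "averaging_operator n \<Phi>" "x \<in> unit_cube n" "i \<in> {1..n}"
    and close: "\<And>j. j \<in> {1..n} \<Longrightarrow> \<bar>x i - x j\<bar> \<le> \<alpha>"
  shows "\<bar>x i - \<Phi> x\<bar> \<le> \<alpha>"
proof -
  have "x ` {1..n} \<noteq> {}"
    using assms(3) by blast
  hence "Min (x ` {1..n}) \<in> x ` {1..n}" "Max (x ` {1..n}) \<in> x ` {1..n}"
    by (intro Min_in Max_in; simp)+
  then obtain p q where "p \<in> {1..n}" "Min (x ` {1..n}) = x p"
    and "q \<in> {1..n}" "Max (x ` {1..n}) = x q"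
    by blast
  moreover have "Min (x ` {1..n}) \<le> \<Phi> x" "\<Phi> x \<le> Max (x ` {1..n})"
    using assms(1,2) by (auto simp: averaging_operator_def)
  ultimately show ?thesis
    using close[of p] close[of q] by linarith
qed

text \<open>Each index belongs to \<open>n - 1\<close> of the unordered pairs, hence is counted that often: a new
  index \<open>n + 1\<close> forms one further pair with each of the \<open>n\<close> indices before it.\<close>

lemma sum_pair_weights:
  fixes w :: "nat \<Rightarrow> real"
  shows "(\<Sum>k=1..n-1. \<Sum>l=k+1..n. w k + w l) = (real n - 1) * (\<Sum>k=1..n. w k)"
proof (induction n)
  case 0
  show ?case by simp
next
  case (Suc n)
  \<comment> \<open>The row of the largest index contains no pairs, so it may be added to the sum.\<close>
  have extend: "(\<Sum>k=1..n-1. \<Sum>l=k+1..n. w k + w l) = (\<Sum>k=1..n. \<Sum>l=k+1..n. w k + w l)"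
    by (cases n) simp_all
  have "(\<Sum>k=1..Suc n-1. \<Sum>l=k+1..Suc n. w k + w l)
      = (\<Sum>k=1..n. (\<Sum>l=k+1..n. w k + w l) + (w k + w (Suc n)))"
    by (intro sum.cong) simp_all
  also have "\<dots> = (real n - 1) * (\<Sum>k=1..n. w k) + (\<Sum>k=1..n. w k) + real n * w (Suc n)"
    using Suc.IH extend by (simp add: sum.distrib)
  also have "\<dots> = (real (Suc n) - 1) * (\<Sum>k=1..Suc n. w k)"
    by (simp add: algebra_simps)
  finally show ?case .
qed

lemma kappa_weighted_le:
  assumes "n \<ge> 2" "\<And>k. k \<in> {1..n} \<Longrightarrow> 0 \<le> w k" "(\<Sum>k=1..n. w k) = 1"
    and close: "\<And>i j. i \<in> {1..n} \<Longrightarrow> j \<in> {1..n} \<Longrightarrow> \<bar>x i - x j\<bar> \<le> \<alpha>"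
  shows "kappa_weighted n w x \<le> \<alpha>"
proof -
  have "kappa_weighted n w x \<le> (\<Sum>k=1..n-1. \<Sum>l=k+1..n. (w k + w l) / (real n - 1) * \<alpha>)"
    unfolding kappa_weighted_def using assms(1)
    by (intro sum_mono mult_left_mono close divide_nonneg_nonneg add_nonneg_nonneg assms(2)) auto
  also have "\<dots> = (\<Sum>k=1..n-1. \<Sum>l=k+1..n. w k + w l) * (\<alpha> / (real n - 1))"
    unfolding sum_distrib_right by (intro sum.cong refl) simp
  also have "\<dots> = \<alpha>"
    using assms(1) unfolding sum_pair_weights assms(3) by simp
  finally show ?thesis .
qed

lemma kappa_weighted_op_le:
  assumes "\<And>k. k \<in> {1..n} \<Longrightarrow> 0 \<le> w k" "(\<Sum>k=1..n. w k) = 1"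
    and close: "\<And>k. k \<in> {1..n} \<Longrightarrow> \<bar>x k - \<Phi> x\<bar> \<le> \<alpha>"
  shows "kappa_weighted_op n w \<Phi> x \<le> \<alpha>"
proof -
  have "kappa_weighted_op n w \<Phi> x \<le> (\<Sum>k=1..n. w k * \<alpha>)"
    unfolding kappa_weighted_op_def by (intro sum_mono mult_left_mono close assms(1))
  also have "\<dots> = \<alpha>"
    using assms(2) by (simp flip: sum_distrib_right)
  finally show ?thesis .
qed

theorem theorem2:
  fixes n :: nat and \<Phi> :: "(nat \<Rightarrow> real) \<Rightarrow> real" and w :: "nat \<Rightarrow> real" and \<alpha> :: real
  assumes "n \<ge> 2"
    and "averaging_operator n \<Phi>"
    and "w \<in> unit_cube n"
    and "(\<Sum>k=1..n. w k) = 1"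
    and "\<alpha> \<in> {0..1}"
  shows "region n \<alpha> \<subseteq> region_op n \<Phi> \<alpha> \<inter> region_weighted_op n w \<Phi> \<alpha> \<inter> region_weighted n w \<alpha>"
proof
  fix x assume x: "x \<in> region n \<alpha>"
  hence cube: "x \<in> unit_cube n"
    by (simp add: region_def)
  have close: "\<bar>x i - x j\<bar> \<le> \<alpha>" if "i \<in> {1..n}" "j \<in> {1..n}" for i j
    using region_pairwise_close[OF x _ that] assms(5) by simp
  have value_close: "\<bar>x i - \<Phi> x\<bar> \<le> \<alpha>" if "i \<in> {1..n}" for i
    using averaging_value_close[OF assms(2) cube that] close that by blast
  have nonneg: "0 \<le> w k" if "k \<in> {1..n}" for k
    using assms(3) that by (auto simp: unit_cube_def dest: PiE_mem)
  have "kappa_op n \<Phi> x \<le> \<alpha>"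
    unfolding kappa_op_def using assms(1) value_close by (subst Max_le_iff) auto
  moreover have "kappa_weighted_op n w \<Phi> x \<le> \<alpha>"
    using nonneg assms(4) value_close by (rule kappa_weighted_op_le)
  moreover have "kappa_weighted n w x \<le> \<alpha>"
    using assms(1) nonneg assms(4) close by (rule kappa_weighted_le)
  ultimately show "x \<in> region_op n \<Phi> \<alpha> \<inter> region_weighted_op n w \<Phi> \<alpha> \<inter> region_weighted n w \<alpha>"
    using cube by (simp add: region_op_def region_weighted_op_def region_weighted_def)
qed

end
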